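(* Let $\mathcal{Y}$ be an $m\times n$ zero-nonzero pattern and let $G$ be the cobipartite graph associated with $\mathcal{Y}$. Then $G$ is saturated with respect to the corresponding clique partition if and only if $Z(G)=m+n-\operatorname{tri}(\mathcal{Y})$.
   Context: A zero-nonzero pattern is a matrix with entries in $\{0,*\}$; a square pattern is a triangle if some row permutation followed by some independent column permutation yields a lower-triangular pattern with only $*$ on the diagonal; $\operatorname{tri}(\mathcal{Y})$ is the largest size of a square submatrix of $\mathcal{Y}$ that is a triangle. The cobipartite graph associated with $\mathcal{Y}$ has vertex set $V_r\cup V_c$ with $V_r=\{r_1,\dots,r_m\}$, $V_c=\{c_1,\dots,c_n\}$ disjoint, each a clique, and $r_i\sim c_j$ iff the $(i,j)$ entry of $\mathcal{Y}$ is $*$; $(V_r,V_c)$ is the corresponding clique partition. $G$ is saturated with respect to it if every vertex of $V_r$ has a neighbor in $V_c$ and every vertex of $V_c$ has a neighbor in $V_r$. $Z(G)$ is the zero forcing number: smallest size of an initially filled set from which repeatedly "a filled vertex whose only unfilled neighbor is $u$ forces $u$ to become filled" fills all vertices.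
   Formalization: The 1×1 zero pattern is excluded, since there G is two isolated vertices, not saturated, yet Z(G) = 2 = 1+1−0, so the equivalence fails; m and n are taken to be at least 1. *)

theory Defs
  imports
    "Jordan_Normal_Form.DL_Submatrix"
    "HOL-Combinatorics.Permutations"
    "Graph_Theory.Pair_Digraph"
begin

datatype entry = Zero | Star

type_synonym pattern = "entry mat"

definition is_triangle :: "pattern \<Rightarrow> bool" where
  "is_triangle T \<longleftrightarrow> square_mat T \<and>
     (\<exists>p q. p permutes {..<dim_row T} \<and> q permutes {..<dim_row T} \<and>
        (\<forall>i<dim_row T. \<forall>j<dim_row T. i < j \<longrightarrow> T $$ (p i, q j) = Zero) \<and>
        (\<forall>i<dim_row T. T $$ (p i, q i) = Star))"

text \<open>The empty submatrix counts as a triangle, so \<open>tri\<close> of an all-zero pattern is 0.\<close>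

definition tri :: "pattern \<Rightarrow> nat" where
  "tri Y = Max {card I | I J. I \<subseteq> {..<dim_row Y} \<and> J \<subseteq> {..<dim_col Y} \<and>
                  card I = card J \<and> is_triangle (submatrix Y I J)}"

text \<open>
  A simple graph is a \<^locale>\<open>pair_graph\<close>: each edge is present as two opposite arcs.
  The row vertex with (0-based) index \<open>i\<close> is \<open>Inl i\<close>, the column vertex with index \<open>j\<close> is \<open>Inr j\<close>.
\<close>

definition row_vertices :: "pattern \<Rightarrow> (nat + nat) set" where
  "row_vertices Y = Inl ` {..<dim_row Y}"

definition col_vertices :: "pattern \<Rightarrow> (nat + nat) set" where
  "col_vertices Y = Inr ` {..<dim_col Y}"

definition cobipartite_graph :: "pattern \<Rightarrow> (nat + nat) pair_pre_digraph" where
  "cobipartite_graph Y =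
     \<lparr> pverts = row_vertices Y \<union> col_vertices Y,
       parcs = {(u, v). u \<in> row_vertices Y \<and> v \<in> row_vertices Y \<and> u \<noteq> v}
             \<union> {(u, v). u \<in> col_vertices Y \<and> v \<in> col_vertices Y \<and> u \<noteq> v}
             \<union> {(Inl i, Inr j) | i j. i < dim_row Y \<and> j < dim_col Y \<and> Y $$ (i, j) = Star}
             \<union> {(Inr j, Inl i) | i j. i < dim_row Y \<and> j < dim_col Y \<and> Y $$ (i, j) = Star} \<rparr>"

lemma pair_graph_cobipartite_graph: "pair_graph (cobipartite_graph Y)"
proof -
  let ?G = "cobipartite_graph Y"
  have fin: "finite (pverts ?G)"
    by (simp add: cobipartite_graph_def row_vertices_def col_vertices_def)
  have sub: "parcs ?G \<subseteq> pverts ?G \<times> pverts ?G"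
    by (auto simp: cobipartite_graph_def row_vertices_def col_vertices_def)
  have "finite (parcs ?G)"
    using fin sub by (meson finite_SigmaI finite_subset)
  moreover have "symmetric (with_proj ?G)"
    unfolding symmetric_def by (auto simp: cobipartite_graph_def sym_def)
  moreover have "fst e \<noteq> snd e" if "e \<in> parcs ?G" for e
    using that by (auto simp: cobipartite_graph_def)
  ultimately show ?thesis
    using fin sub by unfold_locales auto
qed

definition saturated :: "'a pair_pre_digraph \<Rightarrow> 'a set \<Rightarrow> 'a set \<Rightarrow> bool" where
  "saturated G A B \<longleftrightarrow>
     (\<forall>a\<in>A. \<exists>b\<in>B. (a, b) \<in> parcs G) \<and> (\<forall>b\<in>B. \<exists>a\<in>A. (b, a) \<in> parcs G)"

definition forces :: "'a pair_pre_digraph \<Rightarrow> 'a set \<Rightarrow> 'a \<Rightarrow> 'a \<Rightarrow> bool" where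
  "forces G F v u \<longleftrightarrow> v \<in> F \<and> {w. (v, w) \<in> parcs G \<and> w \<notin> F} = {u}"

definition force_step :: "'a pair_pre_digraph \<Rightarrow> 'a set \<Rightarrow> 'a set \<Rightarrow> bool" where
  "force_step G F F' \<longleftrightarrow> (\<exists>v u. forces G F v u \<and> F' = insert u F)"

definition zero_forcing_set :: "'a pair_pre_digraph \<Rightarrow> 'a set \<Rightarrow> bool" where
  "zero_forcing_set G S \<longleftrightarrow> S \<subseteq> pverts G \<and> (force_step G)\<^sup>*\<^sup>* S (pverts G)"

definition zero_forcing_number :: "'a pair_pre_digraph \<Rightarrow> nat" where
  "zero_forcing_number G = Min {card S | S. zero_forcing_set G S}"

text \<open>
  The \<open>1 \<times> 1\<close> zero pattern has to be excluded from the characterisation of saturation by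
  the zero forcing number: its graph consists of two isolated vertices, so it is not saturated,
  but its zero forcing number is \<open>2 = 1 + 1 - 0\<close>.
\<close>

lemma one_by_one_zero_pattern:
  defines "Y \<equiv> mat 1 1 (\<lambda>_. Zero)"
  shows "\<not> saturated (cobipartite_graph Y) (row_vertices Y) (col_vertices Y)"
    and "zero_forcing_number (cobipartite_graph Y) = 2"
    and "tri Y = 0"
proof -
  have rc: "row_vertices Y = {Inl 0}" "col_vertices Y = {Inr 0}"
    by (auto simp: row_vertices_def col_vertices_def Y_def)
  have V: "pverts (cobipartite_graph Y) = {Inl 0, Inr 0}"
    by (auto simp: cobipartite_graph_def rc)
  have E: "parcs (cobipartite_graph Y) = {}"
    by (auto simp: cobipartite_graph_def rc) (auto simp: Y_def)
  show "\<not> saturated (cobipartite_graph Y) (row_vertices Y) (col_vertices Y)"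
    by (simp add: saturated_def rc E)
  have no: "\<not> force_step (cobipartite_graph Y) F F'" for F F'
    by (auto simp: force_step_def forces_def E)
  have "zero_forcing_set (cobipartite_graph Y) S \<longleftrightarrow> S = {Inl 0, Inr 0}" for S
    unfolding zero_forcing_set_def V using no by (auto elim: converse_rtranclpE)
  then show "zero_forcing_number (cobipartite_graph Y) = 2"
    by (simp add: zero_forcing_number_def)
  let ?sizes = "{card I | I J. I \<subseteq> {..<dim_row Y} \<and> J \<subseteq> {..<dim_col Y} \<and>
                  card I = card J \<and> is_triangle (submatrix Y I J)}"
  have zero: "card I = 0" if I: "I \<subseteq> {..<dim_row Y}" and J: "J \<subseteq> {..<dim_col Y}"
    and c: "card I = card J" and T: "is_triangle (submatrix Y I J)" for I J
  proof (rule ccontr)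
    assume "card I \<noteq> 0"
    then have "I \<noteq> {}" by auto
    with I have I1: "I = {0}" by (auto simp: Y_def)
    with c have "J \<noteq> {}" by auto
    with J have J1: "J = {0}" by (auto simp: Y_def)
    have C: "{i. i < Suc 0 \<and> i = 0} = {0}" by auto
    have P: "pick {0} 0 = 0" by simp
    have S: "submatrix Y I J = mat 1 1 (\<lambda>_. Zero)"
      by (rule eq_matI) (simp_all add: submatrix_def I1 J1 Y_def C P)
    from T obtain p q where "p permutes {..<Suc 0}" "q permutes {..<Suc 0}"
      and "mat 1 1 (\<lambda>_. Zero) $$ (p 0, q 0) = Star"
      unfolding S is_triangle_def by auto
    moreover from this have "p 0 = 0" "q 0 = 0"
      using permutes_in_image[of p "{..<Suc 0}" 0] permutes_in_image[of q "{..<Suc 0}" 0] by simp_all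
    ultimately show False by simp
  qed
  have sub: "?sizes \<subseteq> {0}"
  proof
    fix k assume "k \<in> ?sizes"
    then obtain I J where "k = card I" "I \<subseteq> {..<dim_row Y}" "J \<subseteq> {..<dim_col Y}"
      "card I = card J" "is_triangle (submatrix Y I J)"
      unfolding mem_Collect_eq by (elim exE conjE)
    then show "k \<in> {0}" using zero[of I J] by simp
  qed
  have "is_triangle (submatrix Y {} {})"
    by (simp add: is_triangle_def dim_submatrix)
  then have "0 \<in> ?sizes"
    unfolding mem_Collect_eq by (intro exI[of _ "{}"]) simp
  with sub have "?sizes = {0}" by (intro subset_antisym) simp_all
  then show "tri Y = 0" by (simp only: tri_def Max_singleton)
qed

end

(*
  Recording the forces v_0 -> u_0, v_1 -> u_1, ... of a zero forcing process in order gives two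
  sequences such that v_t is adjacent to u_t, while v_s is neither adjacent nor equal to u_t for
  s < t. Conversely the complement of the u's of such a pair of sequences is a zero forcing set, so
  |V| - Z(G) is the maximal length of such a chain. A triangle of the pattern is the same kind of
  object, with the v's among the rows and the u's among the columns, so tri(Y) <= |V| - Z(G) always.
  In a chain that starts with a row vertex, all u's but the first are columns and all v's but the
  last are rows, because both sides are cliques. Saturation lets one replace the first u by a column
  and the last v by a row, which turns the chain into a triangle. If saturation fails, say at a row
  without neighbours among the columns, then this row can first force another row, which makes a
  maximal triangle into a longer chain.
*)

theory Submission
  imports Defs
begin

section \<open>Triangular sequences and triangles of a pattern\<close>

text \<open>These are the rows and columns of a triangle, listed along its diagonal. Allowing any
  relation makes the notion fit both the stars of a pattern and the arcs of a graph.\<close>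

definition triangular :: "('a \<times> 'b) set \<Rightarrow> nat \<Rightarrow> (nat \<Rightarrow> 'a) \<Rightarrow> (nat \<Rightarrow> 'b) \<Rightarrow> bool" where
  "triangular R k a b \<longleftrightarrow> (\<forall>t<k. (a t, b t) \<in> R) \<and> (\<forall>t<k. \<forall>s<t. (a s, b t) \<notin> R)"

text \<open>If \<open>a s = a t\<close> with \<open>s < t\<close>, then \<open>(a t, b t)\<close>
  would lie both in \<open>R\<close> and outside it.\<close>

lemma triangular_inj_left: "triangular R k a b \<Longrightarrow> inj_on a {..<k}"
  unfolding triangular_def by (rule inj_onI) (metis lessThan_iff nat_neq_iff)

lemma triangular_inj_right: "triangular R k a b \<Longrightarrow> inj_on b {..<k}"
  unfolding triangular_def by (rule inj_onI) (metis lessThan_iff nat_neq_iff)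

text \<open>Transposing exchanges the two triangular halves; reversing the order exchanges them
  back.\<close>

lemma triangular_converse:
  assumes "triangular R k a b"
  shows "triangular (R\<inverse>) k (\<lambda>t. b (k - Suc t)) (\<lambda>t. a (k - Suc t))"
  using assms unfolding triangular_def by auto

section \<open>Triangular submatrices as triangular sequences of star positions\<close>

definition star_positions :: "pattern \<Rightarrow> (nat \<times> nat) set" where
  "star_positions Y = {(i, j). i < dim_row Y \<and> j < dim_col Y \<and> Y $$ (i, j) = Star}"

lemma bij_betw_pick:
  assumes "finite I"
  shows "bij_betw (pick I) {..<card I} I"
proof -
  have inj: "inj_on (pick I) {..<card I}"
    by (rule inj_onI) (metis card_pick lessThan_iff)
  moreover have "pick I ` {..<card I} = I"
    using assms pick_in_set[of _ I]
    by (intro card_subset_eq) (auto simp: card_image[OF inj])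
  ultimately show ?thesis by (simp add: bij_betw_def)
qed

lemma dim_submatrix_subset:
  "I \<subseteq> {..<dim_row A} \<Longrightarrow> dim_row (submatrix A I J) = card I"
  "J \<subseteq> {..<dim_col A} \<Longrightarrow> dim_col (submatrix A I J) = card J"
  by (simp_all add: dim_submatrix) (auto intro!: arg_cong[of _ _ card])

lemma submatrix_index_subset:
  assumes "I \<subseteq> {..<dim_row A}" "J \<subseteq> {..<dim_col A}" "i < card I" "j < card J"
  shows "submatrix A I J $$ (i, j) = A $$ (pick I i, pick J j)"
  using assms dim_submatrix_subset(1)[OF assms(1), of J] dim_submatrix_subset(2)[OF assms(2), of I]
  by (intro submatrix_index) (simp_all only: dim_submatrix)

text \<open>A submatrix lists its indices in increasing order through \<open>pick\<close>;
  \<open>p\<close> recovers the prescribed order \<open>f\<close>.\<close>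

lemma pick_permutation:
  assumes "inj_on f {..<k}"
  obtains p where "p permutes {..<k}" "\<And>i. i < k \<Longrightarrow> pick (f ` {..<k}) (p i) = f i"
proof
  let ?I = "f ` {..<k}"
  let ?p = "\<lambda>i. if i < k then the_inv_into {..<k} (pick ?I) (f i) else i"
  have pick: "bij_betw (pick ?I) {..<k} ?I"
    using bij_betw_pick[of ?I] by (simp add: card_image[OF assms])
  have "bij_betw (the_inv_into {..<k} (pick ?I) \<circ> f) {..<k} {..<k}"
    using assms bij_betw_the_inv_into[OF pick]
    by (intro bij_betw_trans) (auto simp: bij_betw_def)
  then have "bij_betw ?p {..<k} {..<k}"
    by (rule bij_betw_cong[THEN iffD1, rotated]) simp
  then show "?p permutes {..<k}"
    by (rule bij_imp_permutes) simp
  show "pick ?I (?p i) = f i" if "i < k" for i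
    using that pick by (simp add: bij_betw_def f_the_inv_into_f)
qed

lemma triangle_imp_triangular:
  assumes I: "I \<subseteq> {..<dim_row Y}" and J: "J \<subseteq> {..<dim_col Y}" and card: "card I = card J"
    and T: "is_triangle (submatrix Y I J)"
  shows "\<exists>a b. triangular (star_positions Y) (card I) a b"
proof -
  obtain p q where p: "p permutes {..<card I}" and q: "q permutes {..<card I}"
    and zero: "\<And>i j. i < j \<Longrightarrow> j < card I \<Longrightarrow> submatrix Y I J $$ (p i, q j) = Zero"
    and star: "\<And>i. i < card I \<Longrightarrow> submatrix Y I J $$ (p i, q i) = Star"
    using T unfolding is_triangle_def dim_submatrix_subset(1)[OF I] by (auto dest: less_trans)
  have lt: "p i < card I" "q i < card J" if "i < card I" for i
    using permutes_in_image[OF p] permutes_in_image[OF q] that by (simp_all add: card)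
  have mem: "pick I (p i) < dim_row Y" "pick J (q i) < dim_col Y" if "i < card I" for i
    using lt[OF that] I J pick_in_set[of "p i" I] pick_in_set[of "q i" J] by auto
  have "triangular (star_positions Y) (card I) (\<lambda>t. pick I (p t)) (\<lambda>t. pick J (q t))"
    unfolding triangular_def star_positions_def
    using zero star mem lt submatrix_index_subset[OF I J] by (fastforce simp flip: card)
  then show ?thesis by blast
qed

lemma triangular_imp_triangle:
  assumes T: "triangular (star_positions Y) k a b"
  defines "I \<equiv> a ` {..<k}" and "J \<equiv> b ` {..<k}"
  shows "I \<subseteq> {..<dim_row Y}" "J \<subseteq> {..<dim_col Y}" "card I = k" "card J = k"
    "is_triangle (submatrix Y I J)"
proof -
  note inj = triangular_inj_left[OF T] triangular_inj_right[OF T]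
  show I: "I \<subseteq> {..<dim_row Y}" and J: "J \<subseteq> {..<dim_col Y}"
    using T by (auto simp: I_def J_def triangular_def star_positions_def)
  show cI: "card I = k" and cJ: "card J = k"
    by (simp_all add: I_def J_def card_image inj)
  obtain p where p: "p permutes {..<k}" "\<And>i. i < k \<Longrightarrow> pick I (p i) = a i"
    using pick_permutation[OF inj(1)] unfolding I_def by blast
  obtain q where q: "q permutes {..<k}" "\<And>i. i < k \<Longrightarrow> pick J (q i) = b i"
    using pick_permutation[OF inj(2)] unfolding J_def by blast
  have entry: "submatrix Y I J $$ (p i, q j) = Y $$ (a i, b j)" if "i < k" "j < k" for i j
    using that permutes_in_image[OF p(1)] permutes_in_image[OF q(1)]
    by (simp add: submatrix_index_subset[OF I J] cI cJ p q)
  have star: "Y $$ (a i, b i) = Star" if "i < k" for i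
    using T that by (auto simp: triangular_def star_positions_def)
  have zero: "Y $$ (a i, b j) = Zero" if "i < j" "j < k" for i j
  proof -
    \<comment> \<open>The two memberships supply the index bounds, so the non-membership can only be
      due to the entry.\<close>
    have "(a i, b j) \<notin> star_positions Y" "(a i, b i) \<in> star_positions Y"
      "(a j, b j) \<in> star_positions Y"
      using T that by (auto simp: triangular_def)
    then show ?thesis
      by (cases "Y $$ (a i, b j)") (auto simp: star_positions_def)
  qed
  show "is_triangle (submatrix Y I J)"
    unfolding is_triangle_def square_mat.simps dim_submatrix_subset(1)[OF I]
      dim_submatrix_subset(2)[OF J] cI cJ
    using p(1) q(1) entry star zero by (intro conjI exI[of _ p] exI[of _ q]) auto
qed

text \<open>Eliminates submatrices and permutations: \<open>tri Y\<close> becomes the maximal length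
  of a triangular sequence.\<close>

lemma triangle_sizes:
  "{card I | I J. I \<subseteq> {..<dim_row Y} \<and> J \<subseteq> {..<dim_col Y} \<and> card I = card J \<and>
      is_triangle (submatrix Y I J)} = {k. \<exists>a b. triangular (star_positions Y) k a b}"
  (is "?L = ?R")
proof
  show "?L \<subseteq> ?R"
    using triangle_imp_triangular by blast
  show "?R \<subseteq> ?L"
  proof
    fix k assume "k \<in> ?R"
    then obtain a b where T: "triangular (star_positions Y) k a b" by blast
    show "k \<in> ?L"
      unfolding mem_Collect_eq using triangular_imp_triangle[OF T] by metis
  qed
qed

lemma finite_triangle_sizes: "finite {k. \<exists>a b. triangular (star_positions Y) k a b}"
proof (rule finite_subset)
  show "{k. \<exists>a b. triangular (star_positions Y) k a b} \<subseteq> {..dim_row Y}"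
    using triangular_imp_triangle(1,3) by (force dest: subset_eq_atLeast0_lessThan_card simp: lessThan_atLeast0)
qed simp

lemma le_tri: "triangular (star_positions Y) k a b \<Longrightarrow> k \<le> tri Y"
  unfolding tri_def triangle_sizes using finite_triangle_sizes by (intro Max_ge) auto

lemma tri_attained: "\<exists>a b. triangular (star_positions Y) (tri Y) a b"
proof -
  have "0 \<in> {k. \<exists>a b. triangular (star_positions Y) k a b}"
    by (simp add: triangular_def)
  then have "tri Y \<in> {k. \<exists>a b. triangular (star_positions Y) k a b}"
    unfolding tri_def triangle_sizes by (intro Max_in finite_triangle_sizes) blast
  then show ?thesis by simp
qed

section \<open>Zero forcing by chains of forces\<close>

text \<open>As there are no loops, the absence of an arc from \<open>v s\<close> to
  \<open>u t\<close> does not exclude \<open>v s = u t\<close>. This needs its own clause, because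
  \<open>v s\<close> is already filled at time \<open>s\<close> and \<open>u t\<close> is
  not.\<close>

definition forcing_chain ::
    "'a pair_pre_digraph \<Rightarrow> nat \<Rightarrow> (nat \<Rightarrow> 'a) \<Rightarrow> (nat \<Rightarrow> 'a) \<Rightarrow> bool" where
  "forcing_chain G k v u \<longleftrightarrow> triangular (parcs G) k v u \<and> (\<forall>t<k. \<forall>s<t. v s \<noteq> u t)"

text \<open>Prepending a force serves both to read a chain off a forcing process and to lengthen a
  triangle.\<close>

lemma forcing_chain_Suc:
  "forcing_chain G (Suc k) (case_nat x v) (case_nat y u) \<longleftrightarrow>
     (x, y) \<in> parcs G \<and> (\<forall>t<k. (x, u t) \<notin> parcs G \<and> x \<noteq> u t) \<and> forcing_chain G k v u"
  unfolding forcing_chain_def triangular_def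
  by (auto simp: All_less_Suc2)

context pair_graph
begin

lemma forcing_chain_imp_zero_forcing_set:
  assumes chain: "forcing_chain G k v u"
  shows "zero_forcing_set G (pverts G - u ` {..<k})"
proof -
  have arc: "(v t, u t) \<in> parcs G" if "t < k" for t
    using chain that by (simp add: forcing_chain_def triangular_def)
  \<comment> \<open>After \<open>t\<close> forces the unfilled vertices are exactly
    \<open>u t\<close>, ..., \<open>u (k - 1)\<close>.\<close>
  have "(force_step G)\<^sup>*\<^sup>* (pverts G - u ` {..<k}) (pverts G - u ` {t..<k})" if "t \<le> k" for t
    using that
  proof (induction t)
    case 0
    then show ?case by (simp add: lessThan_atLeast0)
  next
    case (Suc t)
    let ?F = "pverts G - u ` {t..<k}"
    have split: "{t..<k} = insert t {Suc t..<k}"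
      using Suc.prems by auto
    have later: "(v t, u s) \<notin> parcs G" "u s \<noteq> v t" if "s \<in> {Suc t..<k}" for s
      using chain that unfolding forcing_chain_def triangular_def
      by (metis Suc_le_eq atLeastLessThan_iff)+
    have "v t \<in> ?F"
      using later(2) arc[of t] Suc.prems no_loops'[of "v t" "u t"] in_arcsD1
      by (auto simp: split) metis+
    moreover have "{w. (v t, w) \<in> parcs G \<and> w \<notin> ?F} = {u t}"
      using later(1) arc[of t] Suc.prems in_arcsD2 by (auto simp: split)
    ultimately have "forces G ?F (v t) (u t)"
      by (simp add: forces_def)
    moreover have "pverts G - u ` {Suc t..<k} = insert (u t) ?F"
    proof -
      have "inj_on u {..<k}"
        using chain triangular_inj_right unfolding forcing_chain_def by blast
      then have "u t \<notin> u ` {Suc t..<k}"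
        using Suc.prems by (force dest: inj_onD)
      then show ?thesis
        using arc[of t] Suc.prems in_arcsD2 by (auto simp: split)
    qed
    ultimately have "force_step G ?F (pverts G - u ` {Suc t..<k})"
      unfolding force_step_def by blast
    with Suc show ?case by (auto intro: rtranclp.rtrancl_into_rtrancl)
  qed
  from this[of k] show ?thesis
    by (simp add: zero_forcing_set_def)
qed

text \<open>Induction from the end of the process: the first force \<open>x\<close>,
  \<open>y\<close> is prepended. Later targets lie outside \<open>insert y F\<close>, whereas
  \<open>x\<close> is in \<open>F\<close> and has \<open>y\<close> as its only neighbor outside
  \<open>F\<close>.\<close>

lemma zero_forcing_imp_forcing_chain:
  assumes "(force_step G)\<^sup>*\<^sup>* S (pverts G)"
  shows "\<exists>k v u. forcing_chain G k v u \<and> u ` {..<k} = pverts G - S"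
  using assms
proof (induction rule: converse_rtranclp_induct)
  case base
  have "forcing_chain G 0 undefined undefined"
    by (simp add: forcing_chain_def triangular_def)
  then show ?case by fastforce
next
  case (step F F')
  obtain x y where force: "forces G F x y" and F': "F' = insert y F"
    using step.hyps(1) by (auto simp: force_step_def)
  obtain k v u where chain: "forcing_chain G k v u" and im: "u ` {..<k} = pverts G - F'"
    using step.IH by blast
  have x: "x \<in> F" and nbrs: "{w. (x, w) \<in> parcs G \<and> w \<notin> F} = {y}"
    using force by (simp_all add: forces_def)
  have "u t \<notin> insert y F" if "t < k" for t
    using im that F' by blast
  then have "forcing_chain G (Suc k) (case_nat x v) (case_nat y u)"
    using chain x nbrs by (force simp: forcing_chain_Suc)
  moreover have "case_nat y u ` {..<Suc k} = pverts G - F"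
  proof -
    have "y \<in> pverts G" "y \<notin> F"
      using nbrs in_arcsD2 by auto
    then show ?thesis
      using im by (auto simp: F' lessThan_Suc_eq_insert_0 image_image)
  qed
  ultimately show ?case by blast
qed

lemma forcing_chain_card:
  assumes "forcing_chain G k v u"
  shows "card (u ` {..<k}) = k" "u ` {..<k} \<subseteq> pverts G" "k \<le> card (pverts G)"
proof -
  show card: "card (u ` {..<k}) = k"
    using assms triangular_inj_right unfolding forcing_chain_def by (fastforce dest: card_image)
  show sub: "u ` {..<k} \<subseteq> pverts G"
    using assms in_arcsD2 by (auto simp: forcing_chain_def triangular_def)
  show "k \<le> card (pverts G)"
    using card_mono[OF pair_finite_verts sub] by (simp add: card)
qed

lemma finite_zero_forcing_sizes: "finite {card S | S. zero_forcing_set G S}"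
proof (rule finite_subset)
  show "{card S | S. zero_forcing_set G S} \<subseteq> card ` Pow (pverts G)"
    by (auto simp: zero_forcing_set_def)
qed (simp add: pair_finite_verts)

lemma zero_forcing_number_le:
  assumes "forcing_chain G k v u"
  shows "zero_forcing_number G + k \<le> card (pverts G)"
proof -
  note card = forcing_chain_card[OF assms]
  have "zero_forcing_number G \<le> card (pverts G - u ` {..<k})"
    unfolding zero_forcing_number_def
    using forcing_chain_imp_zero_forcing_set[OF assms]
    by (intro Min_le finite_zero_forcing_sizes) blast
  also have "\<dots> = card (pverts G) - k"
    using card by (simp add: card_Diff_subset finite_subset)
  finally show ?thesis using card(3) by simp
qed

lemma zero_forcing_number_attained:
  "\<exists>k v u. forcing_chain G k v u \<and> zero_forcing_number G + k = card (pverts G)"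
proof -
  have "zero_forcing_set G (pverts G)"
    by (simp add: zero_forcing_set_def)
  then have "zero_forcing_number G \<in> {card S | S. zero_forcing_set G S}"
    unfolding zero_forcing_number_def by (intro Min_in finite_zero_forcing_sizes) blast
  then obtain S where S: "zero_forcing_number G = card S" "S \<subseteq> pverts G"
      "(force_step G)\<^sup>*\<^sup>* S (pverts G)"
    by (auto simp: zero_forcing_set_def)
  obtain k v u where chain: "forcing_chain G k v u" and im: "u ` {..<k} = pverts G - S"
    using zero_forcing_imp_forcing_chain[OF S(3)] by blast
  have "k = card (pverts G) - card S"
    using forcing_chain_card(1)[OF chain] S(2) finite_subset[OF S(2) pair_finite_verts]
    by (simp add: im card_Diff_subset)
  then show ?thesis
    using chain S card_mono[OF pair_finite_verts S(2)] by force
qed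

end

section \<open>Cobipartite graphs\<close>

text \<open>The assumptions are symmetric in \<open>A\<close> and \<open>B\<close>, so every result
  also holds with the sides exchanged.\<close>

locale cobipartite = pair_graph +
  fixes A B
  assumes verts_eq: "pverts G = A \<union> B" and disjoint: "A \<inter> B = {}"
    and clique_left: "x \<in> A \<Longrightarrow> y \<in> A \<Longrightarrow> x \<noteq> y \<Longrightarrow> (x, y) \<in> parcs G"
    and clique_right: "x \<in> B \<Longrightarrow> y \<in> B \<Longrightarrow> x \<noteq> y \<Longrightarrow> (x, y) \<in> parcs G"
begin

definition cross :: "('a \<times> 'a) set" where
  "cross = parcs G \<inter> A \<times> B"

lemma swap: "cobipartite G B A"
  using verts_eq disjoint clique_left clique_right
  by unfold_locales auto

lemma cross_swap: "cobipartite.cross G B A = cross\<inverse>"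
  using arcs_symmetric unfolding cobipartite.cross_def[OF swap] cross_def by auto

lemma swap_triangular:
  assumes "triangular (cobipartite.cross G B A) k a b"
  shows "\<exists>a b. triangular cross k a b"
  using triangular_converse[OF assms] unfolding cross_swap by auto

lemma triangular_imp_forcing_chain:
  assumes "triangular cross k a b"
  shows "forcing_chain G k a b"
proof -
  have "a t \<in> A" "b t \<in> B" if "t < k" for t
    using assms that by (auto simp: triangular_def cross_def)
  moreover from this have "a s \<noteq> b t" if "s < t" "t < k" for s t
    using that disjoint by (metis disjoint_iff less_trans)
  ultimately show ?thesis
    using assms by (auto simp: forcing_chain_def triangular_def cross_def)
qed

lemma forcing_chain_imp_triangular_left:
  assumes sat: "saturated G A B" and chain: "forcing_chain G k v u" and start: "v 0 \<in> A"
  shows "\<exists>a b. triangular cross k a b"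
proof -
  obtain f where f: "f x \<in> B" "(x, f x) \<in> parcs G" if "x \<in> A" for x
    using sat unfolding saturated_def by metis
  obtain g where g: "g y \<in> A" "(g y, y) \<in> parcs G" if "y \<in> B" for y
    using sat arcs_symmetric unfolding saturated_def by metis
  have arc: "(v t, u t) \<in> parcs G" if "t < k" for t
    using chain that by (simp add: forcing_chain_def triangular_def)
  have later: "(v s, u t) \<notin> parcs G" "v s \<noteq> u t" if "s < t" "t < k" for s t
    using chain that by (auto simp: forcing_chain_def triangular_def)
  \<comment> \<open>\<open>v 0\<close> is adjacent or equal to every vertex of \<open>A\<close>, but
    neither to a later \<open>u t\<close>.\<close>
  have u: "u t \<in> B" if "0 < t" "t < k" for t
    using later[OF that] clique_left[OF start, of "u t"] in_arcsD2[OF arc[OF that(2)]] verts_eq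
    by blast
  \<comment> \<open>Otherwise \<open>v t\<close> would be adjacent or equal to
    \<open>u (Suc t)\<close>, which lies in \<open>B\<close>.\<close>
  have v: "v t \<in> A" if "Suc t < k" for t
    using later[of t "Suc t"] that clique_right[of "v t" "u (Suc t)"] u[of "Suc t"]
      in_arcsD1[OF arc[of t]] verts_eq by auto
  \<comment> \<open>Only the last \<open>v\<close> and the first \<open>u\<close> can actually be
    replaced, by neighbors that saturation provides on the required side.\<close>
  define a where "a t = (if v t \<in> A then v t else g (u t))" for t
  define b where "b t = (if u t \<in> B then u t else f (v t))" for t
  have "(a t, b t) \<in> cross" if "t < k" for t
  proof (cases "t = 0")
    case True
    then show ?thesis
      using start arc[OF that] f by (simp add: a_def b_def cross_def)
  next
    case False
    then show ?thesis
      using u that arc[OF that] g by (simp add: a_def b_def cross_def)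
  qed
  \<comment> \<open>Here \<open>s\<close> is not last and \<open>t\<close> is not first, so
    \<open>a s = v s\<close> and \<open>b t = u t\<close>.\<close>
  moreover have "(a s, b t) \<notin> cross" if "t < k" "s < t" for s t
    using that v[of s] u[of t] later[of s t] by (simp add: a_def b_def cross_def)
  ultimately show ?thesis
    unfolding triangular_def by blast
qed

lemma forcing_chain_imp_triangular:
  assumes sat: "saturated G A B" and chain: "forcing_chain G k v u"
  shows "\<exists>a b. triangular cross k a b"
proof (cases "k = 0")
  case True
  then show ?thesis by (simp add: triangular_def)
next
  case False
  then have "v 0 \<in> A \<union> B"
    using chain in_arcsD1 by (auto simp: forcing_chain_def triangular_def simp flip: verts_eq)
  moreover have "saturated G B A"
    using sat by (auto simp: saturated_def)
  ultimately show ?thesis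
    using forcing_chain_imp_triangular_left[OF sat chain] swap_triangular
      cobipartite.forcing_chain_imp_triangular_left[OF swap _ chain] by blast
qed

text \<open>Let \<open>x\<close> force \<open>y\<close> first: \<open>x\<close> is neither adjacent
  nor equal to any \<open>b t\<close>. It is harmless if \<open>y\<close> is some
  \<open>a t\<close>, since the first target is compared with no earlier vertex.\<close>

lemma longer_forcing_chain:
  assumes T: "triangular cross k a b" and x: "x \<in> A" "y \<in> A" "x \<noteq> y"
    and isolated: "\<And>z. z \<in> B \<Longrightarrow> (x, z) \<notin> parcs G"
  shows "\<exists>v u. forcing_chain G (Suc k) v u"
proof -
  have "b t \<in> B" if "t < k" for t
    using T that by (simp add: triangular_def cross_def)
  then have "forcing_chain G (Suc k) (case_nat x a) (case_nat y b)"
    unfolding forcing_chain_Suc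
    using triangular_imp_forcing_chain[OF T] clique_left x isolated disjoint by blast
  then show ?thesis by blast
qed

lemma longer_forcing_chain_swap:
  assumes T: "triangular cross k a b" and x: "x \<in> B" "y \<in> B" "x \<noteq> y"
    and isolated: "\<And>z. z \<in> A \<Longrightarrow> (x, z) \<notin> parcs G"
  shows "\<exists>v u. forcing_chain G (Suc k) v u"
  using cobipartite.longer_forcing_chain[OF swap _ x isolated] triangular_converse[OF T]
  unfolding cross_swap by blast

lemma unsaturated_longer_forcing_chain:
  assumes T: "triangular cross k a b" and unsat: "\<not> saturated G A B"
    and nonempty: "A \<noteq> {}" "B \<noteq> {}"
    and not_two: "\<not> (\<exists>x y. A = {x} \<and> B = {y} \<and> (x, y) \<notin> parcs G)"
  shows "\<exists>v u. forcing_chain G (Suc k) v u"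
proof -
  consider x where "x \<in> A" "\<And>z. z \<in> B \<Longrightarrow> (x, z) \<notin> parcs G"
    | x where "x \<in> B" "\<And>z. z \<in> A \<Longrightarrow> (x, z) \<notin> parcs G"
    using unsat unfolding saturated_def by blast
  then show ?thesis
  proof cases
    case 1
    show ?thesis
    proof (cases "A = {x}")
      \<comment> \<open>Now \<open>x\<close> has no partner in \<open>A\<close> to force. But then
        no vertex of \<open>B\<close> has a neighbor in \<open>A\<close>, and \<open>B\<close> has
        two vertices, so one of them can force the other.\<close>
      case True
      obtain y where y: "y \<in> B" using nonempty by blast
      with True not_two 1 obtain z where "z \<in> B" "z \<noteq> y" by blast
      with y True 1 arcs_symmetric show ?thesis
        by (intro longer_forcing_chain_swap[OF T, of y z]) auto
    next
      case False
      with 1 show ?thesis using longer_forcing_chain[OF T] by blast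
    qed
  next
    case 2
    show ?thesis
    proof (cases "B = {x}")
      case True
      obtain y where y: "y \<in> A" using nonempty by blast
      with True not_two 2 arcs_symmetric obtain z where "z \<in> A" "z \<noteq> y" by blast
      with y True 2 arcs_symmetric show ?thesis
        by (intro longer_forcing_chain[OF T, of y z]) auto
    next
      case False
      with 2 show ?thesis using longer_forcing_chain_swap[OF T] by blast
    qed
  qed
qed

text \<open>\<open>k\<close> is the maximal length of a triangle. Every such triangle is a chain, so
  equality says that no chain is longer.\<close>

lemma saturated_iff_zero_forcing_number:
  assumes T: "triangular cross k a b"
    and max: "\<And>l a b. triangular cross l a b \<Longrightarrow> l \<le> k"
    and "A \<noteq> {}" "B \<noteq> {}" "\<not> (\<exists>x y. A = {x} \<and> B = {y} \<and> (x, y) \<notin> parcs G)"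
  shows "saturated G A B \<longleftrightarrow> zero_forcing_number G + k = card (pverts G)"
proof
  assume sat: "saturated G A B"
  obtain l v u where chain: "forcing_chain G l v u"
    and l: "zero_forcing_number G + l = card (pverts G)"
    using zero_forcing_number_attained by blast
  have "l \<le> k"
    using forcing_chain_imp_triangular[OF sat chain] max by blast
  with l zero_forcing_number_le[OF triangular_imp_forcing_chain[OF T]]
  show "zero_forcing_number G + k = card (pverts G)" by simp
next
  assume "zero_forcing_number G + k = card (pverts G)"
  then show "saturated G A B"
    using unsaturated_longer_forcing_chain[OF T] zero_forcing_number_le assms(3-) by fastforce
qed

end

section \<open>The graph of a pattern\<close>

lemma cobipartite_cobipartite_graph:
  "cobipartite (cobipartite_graph Y) (row_vertices Y) (col_vertices Y)"
proof -
  interpret pair_graph "cobipartite_graph Y"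
    by (rule pair_graph_cobipartite_graph)
  show ?thesis
    by unfold_locales
      (auto simp: cobipartite_graph_def row_vertices_def col_vertices_def)
qed

lemma cross_cobipartite_graph:
  "cobipartite.cross (cobipartite_graph Y) (row_vertices Y) (col_vertices Y) =
     map_prod Inl Inr ` star_positions Y"
  unfolding cobipartite.cross_def[OF cobipartite_cobipartite_graph]
  by (auto simp: cobipartite_graph_def row_vertices_def col_vertices_def star_positions_def)

text \<open>Below \<open>k\<close> the terms are in the ranges of \<open>Inl\<close> and
  \<open>Inr\<close>, so the projections invert them; values from \<open>k\<close> on do not
  matter.\<close>

lemma triangular_map_prod_Inl_Inr:
  assumes "triangular (map_prod Inl Inr ` R) k a b"
  shows "triangular R k (projl \<circ> a) (projr \<circ> b)"
proof -
  have "\<exists>x y. a t = Inl x \<and> b t = Inr y" if "t < k" for t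
    using assms that by (fastforce simp: triangular_def)
  then obtain x y where "\<And>t. t < k \<Longrightarrow> a t = Inl (x t)" "\<And>t. t < k \<Longrightarrow> b t = Inr (y t)"
    by metis
  with assms show ?thesis
    by (fastforce simp: triangular_def image_iff)
qed

theorem theorem5p14:
  fixes Y :: pattern and m n :: nat
  assumes "Y \<in> carrier_mat m n" and "m > 0" and "n > 0"
    and "Y \<noteq> mat 1 1 (\<lambda>_. Zero)"
  shows "saturated (cobipartite_graph Y) (row_vertices Y) (col_vertices Y)
     \<longleftrightarrow> int (zero_forcing_number (cobipartite_graph Y)) = int m + int n - int (tri Y)"
proof -
  interpret cobipartite "cobipartite_graph Y" "row_vertices Y" "col_vertices Y"
    by (rule cobipartite_cobipartite_graph)
  have dims: "dim_row Y = m" "dim_col Y = n"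
    using assms(1) by auto
  obtain a b where "triangular (star_positions Y) (tri Y) a b"
    using tri_attained by blast
  then have T: "triangular cross (tri Y) (Inl \<circ> a) (Inr \<circ> b)"
    by (auto simp: cross_cobipartite_graph triangular_def)
  have max: "l \<le> tri Y" if "triangular cross l a b" for l a b
    using triangular_map_prod_Inl_Inr le_tri that unfolding cross_cobipartite_graph by blast
  have nonempty: "row_vertices Y \<noteq> {}" "col_vertices Y \<noteq> {}"
    using assms dims by (auto simp: row_vertices_def col_vertices_def)
  have cards: "card (row_vertices Y) = m" "card (col_vertices Y) = n"
    by (simp_all add: row_vertices_def col_vertices_def card_image dims)
  \<comment> \<open>Two nonadjacent single vertices arise only from the excluded 1 by 1 zero
    pattern.\<close>
  have not_two: "\<not> (\<exists>x y. row_vertices Y = {x} \<and> col_vertices Y = {y} \<and>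
      (x, y) \<notin> parcs (cobipartite_graph Y))"
  proof
    assume "\<exists>x y. row_vertices Y = {x} \<and> col_vertices Y = {y} \<and>
      (x, y) \<notin> parcs (cobipartite_graph Y)"
    then obtain x y where xy: "row_vertices Y = {x}" "col_vertices Y = {y}"
      "(x, y) \<notin> parcs (cobipartite_graph Y)" by blast
    then have "m = 1" "n = 1"
      using cards by auto
    moreover from this xy have "x = Inl 0" "y = Inr 0"
      by (auto simp: row_vertices_def col_vertices_def dims)
    ultimately have "Y $$ (0, 0) \<noteq> Star"
      using xy(3) by (simp add: cobipartite_graph_def dims)
    then have "Y $$ (0, 0) = Zero"
      by (cases "Y $$ (0, 0)") simp_all
    then have "Y = mat 1 1 (\<lambda>_. Zero)"
      using \<open>m = 1\<close> \<open>n = 1\<close> dims by (intro eq_matI) auto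
    with assms(4) show False ..
  qed
  have "card (pverts (cobipartite_graph Y)) = m + n"
    using disjoint
    by (simp add: verts_eq card_Un_disjoint cards row_vertices_def col_vertices_def dims card_image)
  with saturated_iff_zero_forcing_number[OF T max nonempty not_two] show ?thesis
    by auto
qed

end
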